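(* Let $X$ and $Y$ be reflexive real Banach spaces such that $Y'\subset X'$ (with continuous embedding). Let $A:X\to X'$ be continuously Fréchet differentiable with Fréchet derivative $A'$, and suppose: (a) there is $c>0$ such that $\langle A(u+h)-A(u),h\rangle\ge c\|h\|_X^2$ for all $u,h\in X$; (b) there is $M\geq 0$ such that for every $u\in X$ there is $r=r(u)>0$ such that for all $h\in X$ with $\|h\|_X<r$ one has $\langle A(u+h)-A(u),h\rangle=\langle A'(u)h,h\rangle+\langle w(u,h),h\rangle$ with $w(u,h)\in X'$ satisfying $\|w(u,h)\|_{X'}\le M\|h\|_X^2$. Let $F:X\to X'$ be monotone, continuous, and Newton differentiable with Newton derivative $G_F:X\to\mathcal L(X,X')$. Suppose that at least one of the following holds: (i) for every $u\in X$ and every $h\in X$, the map $w\mapsto\langle G_F(w)h,h\rangle$ is continuous at $w=u$; or (ii) $G_F(u)$ is monotone, i.e. $\langle G_F(u)h,h\rangle\ge0$ for all $h\in X$, for every $u\in X$. Then for every $f\in Y'$ there is a unique solution $u=u(f)\in X$ of $$A(u)+F(u)=f\quad\text{in }X'.$$ Moreover, the map $Y'\ni f\mapsto u(f)\in X$ is Newton differentiable, with a Newton derivative $Y'\ni f\mapsto G_u(f)\in\mathcal L(Y',X)$ defined as follows: for $h\in Y'$, $G_u(f)h$ is the unique solution $w\in X$ of $$A'(u(f))\,w+G_F(u(f))\,w=h\quad\text{in }X'.$$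
   Context: $X'$ denotes the topological dual of $X$, $\langle\cdot,\cdot\rangle$ the duality pairing between $X'$ and $X$, and $\mathcal L(X,Z)$ the bounded linear operators from $X$ to $Z$. An operator $F:X\to X'$ is monotone if $\langle F(u+h)-F(u),h\rangle\ge0$ for all $u,h\in X$. Newton differentiability: let $X,Z$ be real Banach spaces and $D\subset X$ open. A map $F:D\to Z$ is Newton differentiable at $u\in D$ if there are an open neighborhood $\mathcal N(u)\subset D$ of $u$ and a map $G_F:\mathcal N(u)\to\mathcal L(X,Z)$ with $$\lim_{\|h\|_X\to0}\frac{\|F(u+h)-F(u)-G_F(u+h)h\|_Z}{\|h\|_X}=0.$$ $F$ is Newton differentiable with Newton derivative $G_F:D\to\mathcal L(X,Z)$ if this limit relation holds at every $u\in D$. Newton derivatives are in general not unique. *)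

theory Defs
  imports "HOL-Analysis.Analysis"
begin

text \<open>The dual of a normed space \<open>'a\<close> is the type \<open>'a \<Rightarrow>\<^sub>L real\<close>, with the operator norm;
  the duality pairing of \<open>\<phi>\<close> and \<open>x\<close> is the application \<open>\<phi> x\<close>.\<close>

definition bidual_embedding :: "'a::real_normed_vector \<Rightarrow> (('a \<Rightarrow>\<^sub>L real) \<Rightarrow>\<^sub>L real)"
  where "bidual_embedding x = Blinfun (\<lambda>\<phi>. blinfun_apply \<phi> x)"

lemma bidual_embedding_apply [simp]:
  "blinfun_apply (bidual_embedding x) \<phi> = blinfun_apply \<phi> x"
  unfolding bidual_embedding_def
  by (simp add: bounded_linear_Blinfun_apply blinfun.bounded_linear_left)

definition reflexive_space :: "'a::real_normed_vector itself \<Rightarrow> bool"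
  where "reflexive_space _ \<longleftrightarrow>
    surj (bidual_embedding :: 'a \<Rightarrow> (('a \<Rightarrow>\<^sub>L real) \<Rightarrow>\<^sub>L real))"

definition monotone_operator :: "('a::real_normed_vector \<Rightarrow> ('a \<Rightarrow>\<^sub>L real)) \<Rightarrow> bool"
  where "monotone_operator F \<longleftrightarrow> (\<forall>u h. blinfun_apply (F (u + h) - F u) h \<ge> 0)"

text \<open>Note that the derivative is evaluated at the perturbed point \<open>u + h\<close>. The values of \<open>F\<close> and
  \<open>G\<close> outside the open set \<open>D\<close> are irrelevant, since the limit is local.\<close>

definition has_newton_derivative_on ::
  "('a::real_normed_vector \<Rightarrow> 'b::real_normed_vector) \<Rightarrow> ('a \<Rightarrow> ('a \<Rightarrow>\<^sub>L 'b)) \<Rightarrow> 'a set \<Rightarrow> bool"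
  where "has_newton_derivative_on F G D \<longleftrightarrow> open D \<and>
    (\<forall>u\<in>D. ((\<lambda>h. norm (F (u + h) - F u - blinfun_apply (G (u + h)) h) / norm h) \<longlongrightarrow> 0) (at 0))"

end

theory Submission
  imports Defs
begin

text \<open>Strong monotonicity of \<open>A\<close> passes to its derivative, so the symmetric part of \<open>A' 0\<close> is an
  inner product inducing an equivalent norm and \<open>X\<close> is a Hilbert space in disguise. There Minty's
  theorem is elementary: the inequalities \<open>\<langle>T v - f, v - u\<rangle> \<ge> \<parallel>v - u\<parallel>\<^sup>2\<close> on \<open>u\<close> say that \<open>u\<close> lies in a
  certain family of balls; any finitely many of them intersect by Kirszbraun's lemma, hence all of
  them do. Applied to linear operators it gives the Lax-Milgram lemma.

  Testing the Newton expansion of \<open>F\<close> against \<open>t h\<close> for \<open>t \<rightarrow> 0\<close> shows that condition (i)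
  implies condition (ii), so \<open>N = A' + G\<^sub>F\<close> is uniformly coercive at every point. For
  \<open>h = u(f + k) - u(f)\<close> and \<open>w = G\<^sub>u(f + k) k\<close>, the equations give
  \<open>N(u(f + k)) (w - h) = o(\<parallel>h\<parallel>)\<close>, and coercivity together with the Lipschitz bound
  \<open>\<parallel>h\<parallel> = O(\<parallel>k\<parallel>)\<close> yields \<open>w - h = o(\<parallel>k\<parallel>)\<close>.\<close>

section \<open>Hilbert space geometry of a coercive symmetric form\<close>

text \<open>Dividing by \<open>t\<close> and letting \<open>t\<close> tend to 0 from the right
  leaves \<open>p\<close>. This extracts the first-order condition at a minimizer from a quadratic
  expansion along a segment.\<close>

lemma nonneg_of_quadratic:
  fixes p q :: real
  assumes "\<And>t. 0 < t \<Longrightarrow> t \<le> 1 \<Longrightarrow> 0 \<le> t * p + t\<^sup>2 * q"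
  shows "0 \<le> p"
proof (rule tendsto_lowerbound)
  show "((\<lambda>t. p + t * q) \<longlongrightarrow> p) (at_right 0)"
    by (rule tendsto_eq_intros | simp)+
  have "\<forall>\<^sub>F t in at_right 0. 0 < t \<and> t \<le> (1::real)"
    by (auto simp: eventually_at_right_field intro: exI[of _ 1])
  then show "\<forall>\<^sub>F t in at_right 0. 0 \<le> p + t * q"
  proof eventually_elim
    case (elim t)
    then have "0 \<le> t * (p + t * q)"
      using assms[of t] by (simp add: algebra_simps power2_eq_square)
    then show ?case using elim by (simp add: zero_le_mult_iff)
  qed
qed simp

text \<open>A real inner product whose norm is equivalent to that of the Banach space.\<close>

locale coercive_form = bounded_bilinear b
  for b :: "'x::banach \<Rightarrow> 'x \<Rightarrow> real" +
  assumes sym: "b x y = b y x"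
    and coercive: "\<exists>\<alpha>>0. \<forall>x. \<alpha> * (norm x)\<^sup>2 \<le> b x x"
begin

lemmas form_simps = add_left add_right diff_left diff_right minus_left minus_right
  scaleR_left scaleR_right

lemma nonneg: "0 \<le> b x x"
proof -
  obtain \<alpha> where "\<alpha> > 0" "\<alpha> * (norm x)\<^sup>2 \<le> b x x"
    using coercive by blast
  then show ?thesis
    by (meson order_trans mult_nonneg_nonneg less_imp_le zero_le_power2)
qed

lemma LIMSEQ_zero:
  assumes "(\<lambda>n. b (x n) (x n)) \<longlonglongrightarrow> 0"
  shows "x \<longlonglongrightarrow> 0"
proof -
  obtain \<alpha> where \<alpha>: "\<alpha> > 0" "\<And>x. \<alpha> * (norm x)\<^sup>2 \<le> b x x"
    using coercive by blast
  have "(\<lambda>n. sqrt (b (x n) (x n) / \<alpha>)) \<longlonglongrightarrow> sqrt (0 / \<alpha>)"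
    by (intro tendsto_intros assms) (use \<alpha> in auto)
  moreover have "norm (x n) \<le> sqrt (b (x n) (x n) / \<alpha>)" for n
    by (rule real_le_rsqrt) (use \<alpha> in \<open>simp add: field_simps\<close>)
  ultimately show ?thesis
    by (intro Lim_null_comparison[of x]) auto
qed

text \<open>The factor 8 is what the parallelogram law yields for two points whose energies
  \<open>b u u\<close> exceed a level by less than \<epsilon> while the energy of their midpoint
  falls below it by at most \<epsilon>: 2 + 2 + 4 times \<epsilon>. Coercivity transfers the
  estimate to the original norm.\<close>

lemma Cauchy_criterion:
  assumes "\<And>m n. n \<le> m \<Longrightarrow> b (x m - x n) (x m - x n) \<le> 8 * inverse (real (Suc n))"
  shows "Cauchy x"
proof -
  obtain \<alpha> where \<alpha>: "\<alpha> > 0" "\<And>x. \<alpha> * (norm x)\<^sup>2 \<le> b x x"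
    using coercive by blast
  show ?thesis
  proof (rule CauchyI')
    fix e :: real assume "e > 0"
    have "\<alpha> * e\<^sup>2 / 8 > 0" using \<alpha> \<open>e > 0\<close> by simp
    then obtain N where N: "inverse (real (Suc N)) < \<alpha> * e\<^sup>2 / 8"
      using reals_Archimedean by blast
    have "dist (x m) (x n) < e" if "N \<le> m" "m < n" for m n
    proof -
      have "\<alpha> * (norm (x n - x m))\<^sup>2 \<le> 8 * inverse (real (Suc m))"
        using \<alpha>(2)[of "x n - x m"] assms[of m n] that by linarith
      also have "\<dots> \<le> 8 * inverse (real (Suc N))"
        using that by (simp add: le_imp_inverse_le)
      also have "\<dots> < \<alpha> * e\<^sup>2" using N by simp
      finally have "(norm (x n - x m))\<^sup>2 < e\<^sup>2" using \<alpha> by simp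
      then show ?thesis
        using \<open>e > 0\<close> by (simp add: dist_norm norm_minus_commute power_less_imp_less_base)
    qed
    then show "\<exists>M. \<forall>m\<ge>M. \<forall>n>m. dist (x m) (x n) < e" by blast
  qed
qed

lemma parallelogram:
  "b (u - w) (u - w) = 2 * b u u + 2 * b w w - 4 * b ((1/2) *\<^sub>R (u + w)) ((1/2) *\<^sub>R (u + w))"
  by (simp add: form_simps algebra_simps)

text \<open>The representing vector minimizes the energy \<open>b u u - 2 * g u\<close>: a
  minimizing sequence is Cauchy by the parallelogram law, and at its limit the derivative of the
  energy vanishes.\<close>

lemma riesz:
  fixes g :: "'x \<Rightarrow>\<^sub>L real"
  obtains r where "\<And>h. b r h = g h"
proof -
  obtain \<alpha> where \<alpha>: "\<alpha> > 0" "\<And>x. \<alpha> * (norm x)\<^sup>2 \<le> b x x"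
    using coercive by blast
  define \<phi> where "\<phi> u = b u u - 2 * g u" for u
  have lower: "- ((norm g)\<^sup>2 / \<alpha>) \<le> \<phi> u" for u
  proof -
    have "g u \<le> norm g * norm u"
      using norm_blinfun[of g u] by simp
    \<comment> \<open>Young's inequality: the coercive quadratic term absorbs the linear one, so the
      energy is bounded below.\<close>
    moreover have "0 \<le> (\<alpha> * norm u - norm g)\<^sup>2 / \<alpha>" using \<alpha> by simp
    then have "2 * (norm g * norm u) \<le> \<alpha> * (norm u)\<^sup>2 + (norm g)\<^sup>2 / \<alpha>"
      using \<alpha> by (simp add: power2_eq_square field_simps)
    ultimately show ?thesis using \<alpha>(2)[of u] unfolding \<phi>_def by linarith
  qed
  define m where "m = Inf (range \<phi>)"
  have bdd: "bdd_below (range \<phi>)" using lower by (auto intro!: bdd_belowI)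
  have m: "m \<le> \<phi> u" for u
    unfolding m_def by (rule cInf_lower) (use bdd in auto)
  have "\<exists>u. \<phi> u < m + inverse (real (Suc n))" for n
    using cInf_lessD[of "range \<phi>" "m + inverse (real (Suc n))"] unfolding m_def by auto
  then obtain x where x: "\<And>n. \<phi> (x n) < m + inverse (real (Suc n))" by metis
  have "Cauchy x"
  proof (rule Cauchy_criterion)
    fix n k :: nat assume "n \<le> k"
    then have le: "inverse (real (Suc k)) \<le> inverse (real (Suc n))"
      by (simp add: le_imp_inverse_le)
    \<comment> \<open>The linear term cancels in this combination, so the parallelogram law carries
      over from \<open>b\<close> to the energy.\<close>
    have "b (x k - x n) (x k - x n)
        = 2 * \<phi> (x k) + 2 * \<phi> (x n) - 4 * \<phi> ((1/2) *\<^sub>R (x k + x n))"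
      unfolding parallelogram[of "x k" "x n"] \<phi>_def
      by (simp add: blinfun.add_right blinfun.scaleR_right field_simps)
    then show "b (x k - x n) (x k - x n) \<le> 8 * inverse (real (Suc n))"
      using x[of k] x[of n] m[of "(1/2) *\<^sub>R (x k + x n)"] le
        inverse_nonnegative_iff_nonnegative[of "real (Suc n)"] by linarith
  qed
  then obtain u where u: "x \<longlonglongrightarrow> u" using Cauchy_convergent_iff convergent_def by blast
  have "\<phi> u \<le> m"
  proof (rule tendsto_le)
    show "(\<lambda>n. m + inverse (real (Suc n))) \<longlonglongrightarrow> m"
      using tendsto_add[OF tendsto_const LIMSEQ_inverse_real_of_nat, of m] by simp
    show "(\<lambda>n. \<phi> (x n)) \<longlonglongrightarrow> \<phi> u"
      unfolding \<phi>_def by (intro tendsto_intros tendsto u)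
    show "\<forall>\<^sub>F n in sequentially. \<phi> (x n) \<le> m + inverse (real (Suc n))"
      using x by (intro always_eventually) (auto intro: less_imp_le)
  qed simp
  then have min: "\<phi> u \<le> \<phi> v" for v using m order_trans by blast
  \<comment> \<open>The right-hand side is the derivative of the energy at the minimizer
    \<open>u\<close> in direction \<open>h\<close>; using it for \<open>h\<close> and
    \<open>- h\<close> gives equality.\<close>
  have ge: "0 \<le> 2 * (b u h - g h)" for h
  proof (rule nonneg_of_quadratic)
    fix t :: real
    have "\<phi> (u + t *\<^sub>R h) - \<phi> u = t * (2 * (b u h - g h)) + t\<^sup>2 * b h h"
      unfolding \<phi>_def using sym[of h u]
      by (simp add: form_simps blinfun.add_right blinfun.scaleR_right
          algebra_simps power2_eq_square)
    then show "0 \<le> t * (2 * (b u h - g h)) + t\<^sup>2 * b h h"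
      using min[of "u + t *\<^sub>R h"] by linarith
  qed
  have "b u h = g h" for h
    using ge[of h] ge[of "- h"] by (simp add: minus_right blinfun.minus_right)
  then show ?thesis using that by blast
qed

text \<open>Replaces weak compactness: points of almost minimal norm in ever larger finite
  intersections form a Cauchy sequence by the parallelogram law.\<close>

lemma finite_intersection_property:
  assumes cl: "\<And>K. K \<in> \<K> \<Longrightarrow> closed (K :: 'x set)" and conv: "\<And>K. K \<in> \<K> \<Longrightarrow> convex K"
    and K0: "K0 \<in> \<K>" "bounded K0"
    and fip: "\<And>\<F> :: 'x set set. finite \<F> \<Longrightarrow> \<F> \<subseteq> \<K> \<Longrightarrow> \<Inter>\<F> \<noteq> {}"
  shows "\<Inter>\<K> \<noteq> {}"
proof -
  \<comment> \<open>Lower bounds of the energy over finite intersections. Their supremum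
    \<open>S\<close> turns out to be the least energy on the whole intersection.\<close>
  define R where "R = {r. \<exists>\<F>. finite \<F> \<and> \<F> \<subseteq> \<K> \<and> (\<forall>u\<in>\<Inter>\<F>. r \<le> b u u)}"
  define S where "S = Sup R"
  define \<epsilon> where "\<epsilon> n = inverse (real (Suc n))" for n
  have \<epsilon>_pos: "\<epsilon> n > 0" for n by (simp add: \<epsilon>_def)
  have \<epsilon>_mono: "\<epsilon> m \<le> \<epsilon> n" if "n \<le> m" for m n
    using that by (simp add: \<epsilon>_def le_imp_inverse_le)
  obtain C where C: "\<And>u. u \<in> K0 \<Longrightarrow> norm u \<le> C" using K0(2) bounded_iff by metis
  obtain N where N: "\<And>x y. norm (b x y) \<le> norm x * norm y * N" "0 \<le> N" 
    using nonneg_bounded by blast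
  \<comment> \<open>Adding \<open>K0\<close> to a finite family keeps the intersection nonempty and
    provides a point of bounded norm in it.\<close>
  have bdd: "bdd_above R"
  proof (rule bdd_aboveI)
    fix r assume "r \<in> R"
    then obtain \<F> where \<F>: "finite \<F>" "\<F> \<subseteq> \<K>" "\<forall>u\<in>\<Inter>\<F>. r \<le> b u u"
      unfolding R_def by blast
    then obtain u where u: "u \<in> \<Inter>(insert K0 \<F>)"
      using fip[of "insert K0 \<F>"] K0 by auto
    then have "r \<le> b u u" using \<F> by auto
    also have "\<dots> \<le> norm u * norm u * N" using N(1)[of u u] by simp
    also have "\<dots> \<le> C * C * N"
      using C[of u] u N(2) order_trans[OF norm_ge_zero, of u C]
      by (intro mult_right_mono mult_mono) auto
    finally show "r \<le> C * C * N" .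
  qed
  have "0 \<in> R" unfolding R_def using nonneg by (auto intro!: exI[of _ "{}"])
  then have "\<exists>r\<in>R. S - \<epsilon> n < r" for n
    using less_cSup_iff[of R "S - \<epsilon> n"] bdd \<epsilon>_pos[of n] unfolding S_def by auto
  then have "\<exists>\<F>. finite \<F> \<and> \<F> \<subseteq> \<K> \<and> (\<forall>u\<in>\<Inter>\<F>. S - \<epsilon> n \<le> b u u)" for n
    unfolding R_def by (smt (verit, best) mem_Collect_eq)
  then obtain \<F> where \<F>: "\<And>n. finite (\<F> n)" "\<And>n. \<F> n \<subseteq> \<K>"
      "\<And>n u. u \<in> \<Inter>(\<F> n) \<Longrightarrow> S - \<epsilon> n \<le> b u u"
    by metis
  \<comment> \<open>Otherwise \<open>S + \<epsilon> n\<close> would itself be a lower bound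
    collected in \<open>R\<close>, beyond the supremum.\<close>
  have low: "\<exists>u\<in>\<Inter>\<G>. b u u < S + \<epsilon> n" if "finite \<G>" "\<G> \<subseteq> \<K>" for \<G> n
  proof (rule ccontr)
    assume "\<not> ?thesis"
    then have "S + \<epsilon> n \<in> R" unfolding R_def using that by (auto simp: not_less)
    then have "S + \<epsilon> n \<le> S" unfolding S_def by (rule cSup_upper) (rule bdd)
    then show False using \<epsilon>_pos[of n] by simp
  qed
  have near: "b (u - w) (u - w) \<le> 8 * \<epsilon> n"
    if "u \<in> \<Inter>(\<F> n)" "w \<in> \<Inter>(\<F> n)" "b u u < S + \<epsilon> n" "b w w < S + \<epsilon> n" for u w n
  proof -
    have "(1/2) *\<^sub>R (u + w) \<in> \<Inter>(\<F> n)"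
      using that(1,2) conv \<F>(2)[of n]
      by (auto simp: convex_def scaleR_add_right subset_iff)
    then show ?thesis
      using that(3,4) \<F>(3)[of "(1/2) *\<^sub>R (u + w)" n] unfolding parallelogram[of u w]
      by linarith
  qed
  \<comment> \<open>Taking increasing unions puts \<open>x m\<close> into the intersection of the
    family \<open>\<F> n\<close> for every \<open>m \<ge> n\<close>, so that \<open>near\<close>
    compares \<open>x m\<close> with \<open>x n\<close>.\<close>
  define \<G> where "\<G> n = (\<Union>k\<le>n. \<F> k)" for n
  have \<G>: "finite (\<G> n)" "\<G> n \<subseteq> \<K>" "n \<le> m \<Longrightarrow> \<F> n \<subseteq> \<G> m" for n m
    unfolding \<G>_def using \<F> by auto
  obtain x where x: "\<And>n. x n \<in> \<Inter>(\<G> n)" "\<And>n. b (x n) (x n) < S + \<epsilon> n"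
  proof -
    have "\<exists>u\<in>\<Inter>(\<G> n). b u u < S + \<epsilon> n" for n
      by (rule low) (use \<G> in auto)
    then show thesis using that by metis
  qed
  have "Cauchy x"
  proof (rule Cauchy_criterion)
    fix n m :: nat assume "n \<le> m"
    then show "b (x m - x n) (x m - x n) \<le> 8 * inverse (real (Suc n))"
      using near[of "x m" n "x n"] x[of m] x[of n] \<G>(3)[of n m] \<G>(3)[of n n] \<epsilon>_mono[of n m]
      unfolding \<epsilon>_def[symmetric] by fastforce
  qed
  then obtain u where u: "x \<longlonglongrightarrow> u" using Cauchy_convergent_iff convergent_def by blast
  \<comment> \<open>Adjoining \<open>K\<close> to the finite families gives points
    \<open>w n\<close> of \<open>K\<close> of almost minimal energy. They stay close to
    \<open>x n\<close>, hence share its limit, and \<open>K\<close> is closed.\<close>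
  have "u \<in> K" if K: "K \<in> \<K>" for K
  proof -
    have "\<exists>w\<in>\<Inter>(insert K (\<G> n)). b w w < S + \<epsilon> n" for n
      by (rule low) (use \<G> K in auto)
    then obtain w where w: "\<And>n. w n \<in> \<Inter>(insert K (\<G> n))" "\<And>n. b (w n) (w n) < S + \<epsilon> n"
      by metis
    have le: "b (w n - x n) (w n - x n) \<le> 8 * \<epsilon> n" for n
      using near[of "w n" n "x n"] w[of n] x[of n] \<G>(3)[of n n] by fastforce
    have lim: "(\<lambda>n. 8 * \<epsilon> n) \<longlonglongrightarrow> 0"
      using tendsto_mult_right_zero[OF LIMSEQ_inverse_real_of_nat] unfolding \<epsilon>_def by blast
    have "(\<lambda>n. w n - x n) \<longlonglongrightarrow> 0"
      by (rule LIMSEQ_zero, rule Lim_null_comparison[OF _ lim]) (simp add: nonneg le)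
    from tendsto_add[OF this u] have "w \<longlonglongrightarrow> u" by simp
    moreover have "w n \<in> K" for n using w(1)[of n] by simp
    ultimately show ?thesis using cl[OF K] closed_sequentially by blast
  qed
  then show ?thesis by blast
qed

text \<open>The point \<open>u\<close> is the first component of a minimizer of \<open>b x x - a\<close> over the convex hull of
  the triples \<open>(p i, q i, b (p i) (p i) - b (q i) (q i))\<close>, which is the Lagrange dual of minimizing
  \<open>max\<^sub>i (b (u - p i) (u - p i) - b (q i) (q i))\<close>.\<close>

lemma kirszbraun_finite:
  assumes "finite I" and le: "\<And>i k. i \<in> I \<Longrightarrow> k \<in> I \<Longrightarrow>
      b (p i - p k) (p i - p k) \<le> b (q i - q k) (q i - q k)"
  obtains u where "\<And>i. i \<in> I \<Longrightarrow> b (u - p i) (u - p i) \<le> b (q i) (q i)"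
proof (cases "I = {}")
  case False
  define s where "s i = b (p i) (p i) - b (q i) (q i)" for i
  define P where "P = (\<lambda>i. (p i, q i, s i)) ` I"
  define C where "C = convex hull P"
  \<comment> \<open>At generators with indices \<open>i\<close> and \<open>k\<close>,
    \<open>E\<close> equals \<open>b (q i - q k) (q i - q k) - b (p i - p k) (p i - p k)\<close>,
    which the hypothesis makes nonnegative.\<close>
  define E where "E = (\<lambda>(x, y, a) (x', y', a'). 2 * b x x' - 2 * b y y' - a - a')"
  have E_sym: "E z z' = E z' z" for z z'
    unfolding E_def using sym by (auto split: prod.splits)
  have convE: "convex {z. 0 \<le> E z z'}" for z'
  proof (rule convexI)
    fix z1 z2 and c d :: real
    assume *: "z1 \<in> {z. 0 \<le> E z z'}" "z2 \<in> {z. 0 \<le> E z z'}" "0 \<le> c" "0 \<le> d" "c + d = 1"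
    \<comment> \<open>\<open>E\<close> is affine rather than linear in each argument; the last term
      is the defect, and it vanishes for convex combinations.\<close>
    have "E (c *\<^sub>R z1 + d *\<^sub>R z2) z' = c * E z1 z' + d * E z2 z' - (1 - (c + d)) * snd (snd z')"
      unfolding E_def by (cases z1; cases z2; cases z') (simp add: form_simps algebra_simps)
    then show "c *\<^sub>R z1 + d *\<^sub>R z2 \<in> {z. 0 \<le> E z z'}" using * by simp
  qed
  have E1: "0 \<le> E z z'" if z: "z \<in> P" and z': "z' \<in> P" for z z'
  proof -
    obtain i where "i \<in> I" "z = (p i, q i, s i)" using z by (auto simp: P_def)
    moreover obtain k where "k \<in> I" "z' = (p k, q k, s k)" using z' by (auto simp: P_def)
    ultimately show ?thesis
      using le[of i k] sym[of "p k" "p i"] sym[of "q k" "q i"]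
      by (simp add: E_def s_def form_simps)
  qed
  \<comment> \<open>Nonnegativity spreads to the convex hull in one argument at a time.\<close>
  have E2: "0 \<le> E z z'" if "z \<in> C" "z' \<in> P" for z z'
    using hull_minimal[of P "{z. 0 \<le> E z z'}" convex] convE E1 that unfolding C_def by blast
  have E3: "0 \<le> E z z'" if "z \<in> C" "z' \<in> C" for z z'
  proof -
    have "P \<subseteq> {y. 0 \<le> E y z}" using E2[OF that(1)] E_sym[of _ z] by auto
    then have "C \<subseteq> {y. 0 \<le> E y z}" unfolding C_def by (rule hull_minimal) (rule convE)
    then show ?thesis using that(2) E_sym[of z z'] by auto
  qed
  define \<Psi> where "\<Psi> = (\<lambda>(x, y :: 'x, a). b x x - a)"
  have "compact C"
    unfolding C_def P_def by (intro finite_imp_compact_convex_hull finite_imageI assms)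
  moreover have "C \<noteq> {}" unfolding C_def P_def using False by simp
  moreover have "continuous_on C \<Psi>"
    unfolding \<Psi>_def case_prod_beta by (intro continuous_intros continuous_on)
  ultimately obtain z where z: "z \<in> C" "\<And>z'. z' \<in> C \<Longrightarrow> \<Psi> z \<le> \<Psi> z'"
    using continuous_attains_inf by metis
  obtain u v a where zeq: "z = (u, v, a)" by (cases z)
  \<comment> \<open>The diagonal of \<open>E\<close> bounds the third component of the
    minimizer.\<close>
  have "0 \<le> b u u - b v v - a" using E3[OF z(1) z(1)] by (simp add: E_def zeq)
  then have a: "a \<le> b u u" using nonneg[of v] by linarith
  have "b (u - p i) (u - p i) \<le> b (q i) (q i)" if i: "i \<in> I" for i
  proof -
    \<comment> \<open>The first-order condition for \<open>\<Psi>\<close> on the segment from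
      \<open>z\<close> to the generator with index \<open>i\<close>.\<close>
    have "0 \<le> 2 * b u (p i - u) - (s i - a)"
    proof (rule nonneg_of_quadratic)
      fix t :: real assume t: "0 < t" "t \<le> 1"
      have "(p i, q i, s i) \<in> C" unfolding C_def P_def using i by (auto intro: hull_inc)
      then have "(1 - t) *\<^sub>R z + t *\<^sub>R (p i, q i, s i) \<in> C"
        using z(1) t convexD_alt[OF convex_convex_hull[of P], of z "(p i, q i, s i)" t]
        unfolding C_def by auto
      moreover have "\<Psi> ((1 - t) *\<^sub>R z + t *\<^sub>R (p i, q i, s i)) - \<Psi> z
          = t * (2 * b u (p i - u) - (s i - a)) + t\<^sup>2 * b (p i - u) (p i - u)"
        using sym[of "p i" u]
        by (simp add: \<Psi>_def zeq form_simps algebra_simps power2_eq_square)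
      ultimately show "0 \<le> t * (2 * b u (p i - u) - (s i - a)) + t\<^sup>2 * b (p i - u) (p i - u)"
        using z(2) by (smt (verit))
    qed
    \<comment> \<open>Expanding the square and inserting this condition,
      \<open>b (u - p i) (u - p i) - b (q i) (q i)\<close> is at most \<open>a - b u u\<close>,
      which is nonpositive.\<close>
    then show ?thesis
      using a sym[of "p i" u] by (simp add: s_def form_simps)
  qed
  then show ?thesis using that by blast
qed (use that in auto)

section \<open>Minty's theorem\<close>

theorem minty_surjective:
  fixes T :: "'x \<Rightarrow> ('x \<Rightarrow>\<^sub>L real)"
  assumes cont: "continuous_on UNIV T"
    and mono: "\<And>u v. b (u - v) (u - v) \<le> blinfun_apply (T u - T v) (u - v)"
  obtains u where "T u = f"
proof -
  have "\<exists>r. \<forall>h. b r h = blinfun_apply (T v - f) h" for v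
    using riesz[of "T v - f"] by metis
  then obtain r where r: "\<And>v h. b (r v) h = blinfun_apply (T v - f) h" by metis
  \<comment> \<open>Completing the square: Minty's inequality at \<open>v\<close> describes the ball
    with centre \<open>v - r v / 2\<close> whose radius is half the \<open>b\<close>-norm of
    \<open>r v\<close>. Here \<open>r v\<close> is the Riesz representative of
    \<open>T v - f\<close>.\<close>
  define q where "q v = (1/2) *\<^sub>R r v" for v
  define p where "p v = v - q v" for v
  define K where "K v = {u. b (u - p v) (u - p v) \<le> b (q v) (q v)}" for v
  have K: "u \<in> K v \<longleftrightarrow> b (u - v) (u - v) \<le> blinfun_apply (T v - f) (v - u)" for u v
  proof -
    have "b (u - p v) (u - p v) - b (q v) (q v) = b (u - v) (u - v) - b (r v) (v - u)"
      using sym[of "r v" v] sym[of "r v" u] sym[of u v]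
      by (simp add: p_def q_def form_simps field_simps)
    then show ?thesis unfolding K_def r[symmetric] by auto
  qed
  have "\<Inter>(range K) \<noteq> {}"
  proof (rule finite_intersection_property)
    fix L assume "L \<in> range K"
    then obtain v where L: "L = K v" by blast
    show "closed L" unfolding L K_def
      by (intro closed_Collect_le continuous_intros continuous_on)
    show "convex L"
    proof (rule convexI)
      fix x y and c d :: real assume *: "x \<in> L" "y \<in> L" "0 \<le> c" "0 \<le> d" "c + d = 1"
      define x' y' where "x' = x - p v" and "y' = y - p v"
      have d: "d = 1 - c" using * by simp
      have eq: "c *\<^sub>R x + d *\<^sub>R y - p v = c *\<^sub>R x' + d *\<^sub>R y'"
        by (simp add: x'_def y'_def d algebra_simps)
      have "b (c *\<^sub>R x' + d *\<^sub>R y') (c *\<^sub>R x' + d *\<^sub>R y')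
          = c * b x' x' + d * b y' y' - c * d * b (x' - y') (x' - y')"
        using sym[of y' x'] by (simp add: d form_simps algebra_simps)
      also have "\<dots> \<le> c * b x' x' + d * b y' y'"
        using * nonneg by simp
      also have "\<dots> \<le> c * b (q v) (q v) + d * b (q v) (q v)"
        using * by (intro add_mono mult_left_mono) (auto simp: L K_def x'_def y'_def)
      also have "\<dots> = b (q v) (q v)" by (simp add: d algebra_simps)
      finally show "c *\<^sub>R x + d *\<^sub>R y \<in> L" by (simp add: L K_def eq)
    qed
  next
    show "K 0 \<in> range K" by simp
    obtain \<alpha> where \<alpha>: "\<alpha> > 0" "\<And>x. \<alpha> * (norm x)\<^sup>2 \<le> b x x"
      using coercive by blast
    have "norm u \<le> norm (p 0) + sqrt (b (q 0) (q 0) / \<alpha>)" if "u \<in> K 0" for u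
    proof -
      have "norm (u - p 0) \<le> sqrt (b (q 0) (q 0) / \<alpha>)"
        using \<alpha>(2)[of "u - p 0"] that \<alpha>(1)
        by (intro real_le_rsqrt) (simp add: K_def field_simps)
      then show ?thesis using norm_triangle_sub[of u "p 0"] by simp
    qed
    then show "bounded (K 0)" unfolding bounded_iff by blast
  next
    fix \<F> assume "finite \<F>" "\<F> \<subseteq> range K"
    then obtain V where V: "finite V" "\<F> = K ` V" using finite_subset_image by metis
    \<comment> \<open>Monotonicity with constant one in the form \<open>b\<close> is exactly the
      hypothesis of Kirszbraun's lemma for centres \<open>p\<close> and radius vectors
      \<open>q\<close>.\<close>
    have "b (p i - p k) (p i - p k) \<le> b (q i - q k) (q i - q k)" for i k
    proof -
      have "b (i - k) (i - k) \<le> b (r i - r k) (i - k)"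
        using mono[of i k] by (simp add: r diff_left blinfun.diff_left)
      moreover have "b (p i - p k) (p i - p k)
          = b (q i - q k) (q i - q k) + b (i - k) (i - k) - b (r i - r k) (i - k)"
        using sym[of i k] sym[of i "r k"] sym[of k "r i"] sym[of i "r i"] sym[of k "r k"]
        by (simp add: p_def q_def form_simps algebra_simps)
      ultimately show ?thesis by linarith
    qed
    then obtain u where "\<And>i. i \<in> V \<Longrightarrow> b (u - p i) (u - p i) \<le> b (q i) (q i)"
      using kirszbraun_finite[OF V(1)] by metis
    then have "u \<in> \<Inter>\<F>" using V by (auto simp: K_def)
    then show "\<Inter>\<F> \<noteq> {}" by blast
  qed
  then obtain u where u: "\<And>v. u \<in> K v" by blast
  \<comment> \<open>Minty's trick: test the inequalities at \<open>v = u + t *\<^sub>R h\<close>,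
    divide by \<open>t\<close>, and let \<open>t\<close> tend to 0 using the continuity of
    \<open>T\<close>.\<close>
  have ge: "0 \<le> blinfun_apply (T u - f) h" for h
  proof (rule tendsto_lowerbound)
    have "isCont T u" using cont by (simp add: continuous_on_eq_continuous_at)
    moreover have "((\<lambda>t. u + t *\<^sub>R h) \<longlongrightarrow> u) (at_right 0)"
      by (rule tendsto_eq_intros | simp)+
    ultimately have "((\<lambda>t. T (u + t *\<^sub>R h)) \<longlongrightarrow> T u) (at_right 0)"
      using isCont_tendsto_compose by blast
    then show "((\<lambda>t. blinfun_apply (T (u + t *\<^sub>R h) - f) h) \<longlongrightarrow> blinfun_apply (T u - f) h) (at_right 0)"
      by (intro tendsto_intros)
    have "\<forall>\<^sub>F t in at_right 0. (0::real) < t" by (simp add: eventually_at_right_less)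
    then show "\<forall>\<^sub>F t in at_right 0. 0 \<le> blinfun_apply (T (u + t *\<^sub>R h) - f) h"
    proof eventually_elim
      case (elim t)
      have "0 \<le> blinfun_apply (T (u + t *\<^sub>R h) - f) (t *\<^sub>R h)"
        using u[of "u + t *\<^sub>R h"] nonneg[of "u - (u + t *\<^sub>R h)"] unfolding K by simp
      then show ?case using elim by (simp add: blinfun.scaleR_right zero_le_mult_iff)
    qed
  qed simp
  have "T u = f"
  proof (rule blinfun_eqI)
    fix h show "T u h = f h"
      using ge[of h] ge[of "- h"] by (simp add: blinfun.minus_right blinfun.diff_left)
  qed
  then show ?thesis using that by blast
qed

end


section \<open>Strongly monotone and coercive operators on Banach spaces\<close>

text \<open>One factor of the norm cancels. This supplies injectivity, bounds for inverses and the
  Lipschitz estimate for solutions.\<close>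

lemma norm_le_if_coercive:
  fixes \<phi> :: "'x::real_normed_vector \<Rightarrow>\<^sub>L real"
  assumes "c * (norm x)\<^sup>2 \<le> \<phi> x"
  shows "c * norm x \<le> norm \<phi>"
proof (cases "x = 0")
  case False
  have "c * norm x * norm x \<le> norm \<phi> * norm x"
    using assms norm_blinfun[of \<phi> x] by (simp add: power2_eq_square algebra_simps)
  then show ?thesis using False by simp
qed simp

text \<open>The coercive operator \<open>B\<close> only supplies the inner product: its symmetric
  part, suitably scaled, is dominated by the strong monotonicity of the possibly nonlinear
  \<open>T\<close>, so Minty's theorem applies.\<close>

lemma strongly_monotone_surjective:
  fixes T :: "'x::banach \<Rightarrow> ('x \<Rightarrow>\<^sub>L real)" and B :: "'x \<Rightarrow>\<^sub>L ('x \<Rightarrow>\<^sub>L real)"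
  assumes cont: "continuous_on UNIV T"
    and mono: "c > 0" "\<And>u v. c * (norm (u - v))\<^sup>2 \<le> blinfun_apply (T u - T v) (u - v)"
    and B: "\<alpha> > 0" "\<And>h. \<alpha> * (norm h)\<^sup>2 \<le> blinfun_apply (B h) h"
  obtains u where "T u = f"
proof -
  \<comment> \<open>The scaling ensures \<open>K * norm B \<le> c\<close>; the summand 1 keeps the
    denominator positive even on the trivial space.\<close>
  define K where "K = c / (norm B + 1)"
  have K: "K > 0" "K * norm B \<le> c"
    using mono(1) add_nonneg_pos[OF norm_ge_zero[of B] zero_less_one] unfolding K_def
    by (simp_all add: pos_divide_le_eq distrib_left)
  define b where "b x y = (K / 2) * (blinfun_apply (B x) y + blinfun_apply (B y) x)" for x y
  have diag: "b x x = K * blinfun_apply (B x) x" for x by (simp add: b_def)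
  have B_le: "blinfun_apply (B x) y \<le> norm B * norm x * norm y"
    "- blinfun_apply (B x) y \<le> norm B * norm x * norm y" for x y
    using norm_blinfun[of "B x" y] mult_right_mono[OF norm_blinfun[of B x], of "norm y"] by auto
  interpret coercive_form b
  proof
    show "\<exists>C. \<forall>x y. norm (b x y) \<le> norm x * norm y * C"
    proof (intro exI allI)
      fix x y
      have "\<bar>blinfun_apply (B x) y + blinfun_apply (B y) x\<bar> \<le> 2 * (norm B * norm x * norm y)"
        using B_le[of x y] B_le[of y x] by (simp add: abs_le_iff algebra_simps)
      then have "(K / 2) * \<bar>blinfun_apply (B x) y + blinfun_apply (B y) x\<bar>
          \<le> (K / 2) * (2 * (norm B * norm x * norm y))"
        using K(1) by (intro mult_left_mono) auto
      moreover have "norm (b x y) = (K / 2) * \<bar>blinfun_apply (B x) y + blinfun_apply (B y) x\<bar>"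
        using K(1) by (simp add: b_def abs_mult)
      ultimately show "norm (b x y) \<le> norm x * norm y * (K * norm B)"
        by (simp add: algebra_simps)
    qed
    show "\<exists>\<alpha>>0. \<forall>x. \<alpha> * (norm x)\<^sup>2 \<le> b x x"
      using B K by (intro exI[of _ "K * \<alpha>"]) (simp add: diag)
  qed (simp_all add: b_def blinfun.bilinear_simps algebra_simps)
  have "b (u - v) (u - v) \<le> blinfun_apply (T u - T v) (u - v)" for u v
  proof -
    have "b (u - v) (u - v) \<le> K * (norm B * norm (u - v) * norm (u - v))"
      unfolding diag
      using K(1) B_le(1) by (intro mult_left_mono) auto
    also have "\<dots> \<le> c * (norm (u - v))\<^sup>2"
      using mult_right_mono[OF K(2), of "(norm (u - v))\<^sup>2"]
      by (simp add: power2_eq_square algebra_simps)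
    finally show ?thesis using mono(2)[of u v] by linarith
  qed
  then show ?thesis using minty_surjective[OF cont] that by metis
qed

lemma lax_milgram:
  fixes L :: "'x::banach \<Rightarrow>\<^sub>L ('x \<Rightarrow>\<^sub>L real)"
  assumes c: "c > 0" "\<And>h. c * (norm h)\<^sup>2 \<le> blinfun_apply (L h) h"
  obtains J :: "('x \<Rightarrow>\<^sub>L real) \<Rightarrow>\<^sub>L 'x"
  where "\<And>g w. blinfun_apply L w = g \<longleftrightarrow> w = blinfun_apply J g"
proof -
  have "\<exists>w. blinfun_apply L w = g" for g
    \<comment> \<open>Here \<open>L\<close> plays both roles, the monotone map and the source of the
      inner product.\<close>
    using strongly_monotone_surjective[of "blinfun_apply L" c c L g] c
    by (metis blinfun.diff_right linear_continuous_on blinfun.bounded_linear_right)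
  then obtain W where W: "\<And>g. blinfun_apply L (W g) = g" by metis
  have lower: "c * norm w \<le> norm (blinfun_apply L w)" for w
    by (rule norm_le_if_coercive) (rule c(2))
  have uniq: "w = w'" if "blinfun_apply L w = blinfun_apply L w'" for w w'
    using lower[of "w - w'"] that c(1)
    by (simp add: blinfun.diff_right mult_le_0_iff)
  have "bounded_linear W"
  proof (rule bounded_linear_intro)
    show "W (x + y) = W x + W y" for x y by (rule uniq) (simp add: W blinfun.add_right)
    show "W (r *\<^sub>R x) = r *\<^sub>R W x" for r x by (rule uniq) (simp add: W blinfun.scaleR_right)
    show "norm (W x) \<le> norm x * (1 / c)" for x
      using lower[of "W x"] c(1) by (simp add: W field_simps)
  qed
  then have "blinfun_apply L w = g \<longleftrightarrow> w = blinfun_apply (Blinfun W) g" for g w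
    using W uniq by (auto simp: bounded_linear_Blinfun_apply)
  then show ?thesis using that by blast
qed

section \<open>Newton differentiability\<close>

text \<open>Multiplying out the quotient admits \<open>h = 0\<close>, where both sides vanish, and
  gives an estimate usable without case distinctions.\<close>

lemma has_newton_derivative_UNIV_iff:
  "has_newton_derivative_on F G UNIV \<longleftrightarrow> (\<forall>u. \<forall>e>0. \<exists>d>0. \<forall>h. norm h < d \<longrightarrow>
     norm (F (u + h) - F u - blinfun_apply (G (u + h)) h) \<le> e * norm h)"
  (is "_ \<longleftrightarrow> (\<forall>u. ?P u)")
proof -
  have "((\<lambda>h. norm (F (u + h) - F u - blinfun_apply (G (u + h)) h) / norm h) \<longlongrightarrow> 0) (at 0)
      \<longleftrightarrow> ?P u" (is "(?q \<longlongrightarrow> 0) (at 0) \<longleftrightarrow> _") for u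
  proof
    assume lim: "(?q \<longlongrightarrow> 0) (at 0)"
    show "?P u"
    proof (intro allI impI)
      fix e :: real assume "e > 0"
      then obtain d where d: "d > 0" "\<And>h. h \<noteq> 0 \<Longrightarrow> norm h < d \<Longrightarrow> ?q h < e"
        using LIM_D[OF lim, of e] by auto
      have "norm (F (u + h) - F u - blinfun_apply (G (u + h)) h) \<le> e * norm h"
        if "norm h < d" for h
        using d(2)[of h] that by (cases "h = 0") (auto simp: field_simps blinfun.zero_right)
      then show "\<exists>d>0. \<forall>h. norm h < d \<longrightarrow>
          norm (F (u + h) - F u - blinfun_apply (G (u + h)) h) \<le> e * norm h"
        using d(1) by blast
    qed
  next
    assume P: "?P u"
    show "(?q \<longlongrightarrow> 0) (at 0)"
    proof (rule LIM_I)
      fix e :: real assume e: "e > 0"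
      then obtain d where d: "d > 0" "\<And>h. norm h < d \<Longrightarrow>
          norm (F (u + h) - F u - blinfun_apply (G (u + h)) h) \<le> (e / 2) * norm h"
        using P half_gt_zero by blast
      have "norm (?q h - 0) < e" if "h \<noteq> 0" "norm (h - 0) < d" for h
      proof -
        have "?q h \<le> e / 2" using d(2)[of h] that by (simp add: divide_le_eq)
        also have "\<dots> < e" using e by simp
        finally show ?thesis by simp
      qed
      then show "\<exists>d>0. \<forall>h. h \<noteq> 0 \<and> norm (h - 0) < d \<longrightarrow> norm (?q h - 0) < e"
        using d(1) by blast
    qed
  qed
  then show ?thesis by (simp add: has_newton_derivative_on_def)
qed

text \<open>Continuity of \<open>A'\<close> makes \<open>(A' (u + h) - A' u) h\<close> of order
  o(h), so the derivative may be evaluated at the perturbed point. Thus \<open>A\<close> and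
  \<open>F\<close> can be treated by the same Newton calculus.\<close>

lemma C1_has_newton_derivative:
  assumes deriv: "\<And>u. (A has_derivative blinfun_apply (A' u)) (at u)"
    and cont: "continuous_on UNIV A'"
  shows "has_newton_derivative_on A A' UNIV"
  unfolding has_newton_derivative_UNIV_iff
proof (intro allI impI)
  fix u and e :: real assume "e > 0"
  then have e: "e / 2 > 0" by simp
  obtain d1 where d1: "d1 > 0" "\<And>y. norm (y - u) < d1 \<Longrightarrow>
      norm (A y - A u - blinfun_apply (A' u) (y - u)) \<le> (e / 2) * norm (y - u)"
    using deriv[of u] e unfolding has_derivative_at_alt by blast
  have "isCont A' u" using cont by (simp add: continuous_on_eq_continuous_at)
  then obtain d2 where d2: "d2 > 0" "\<And>y. dist y u < d2 \<Longrightarrow> dist (A' y) (A' u) < e / 2"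
    using e unfolding continuous_at_eps_delta by blast
  have "norm (A (u + h) - A u - blinfun_apply (A' (u + h)) h) \<le> e * norm h"
    if "norm h < min d1 d2" for h
  proof -
    have "norm (A (u + h) - A u - blinfun_apply (A' u) h) \<le> (e / 2) * norm h"
      using d1(2)[of "u + h"] that by simp
    moreover have "norm (blinfun_apply (A' (u + h) - A' u) h) \<le> (e / 2) * norm h"
      using norm_blinfun[of "A' (u + h) - A' u" h] d2(2)[of "u + h"] that
        mult_right_mono[of "norm (A' (u + h) - A' u)" "e / 2" "norm h"]
      by (simp add: dist_norm)
    moreover have "norm (A (u + h) - A u - blinfun_apply (A' (u + h)) h)
        \<le> norm (A (u + h) - A u - blinfun_apply (A' u) h) + norm (blinfun_apply (A' (u + h) - A' u) h)"
      using norm_triangle_ineq4[of "A (u + h) - A u - blinfun_apply (A' u) h"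
          "blinfun_apply (A' (u + h) - A' u) h"] by (simp add: blinfun.diff_left)
    ultimately show ?thesis by linarith
  qed
  then show "\<exists>d>0. \<forall>h. norm h < d \<longrightarrow>
      norm (A (u + h) - A u - blinfun_apply (A' (u + h)) h) \<le> e * norm h"
    using d1(1) d2(1) by (intro exI[of _ "min d1 d2"]) simp
qed

lemma has_newton_derivative_add:
  assumes "has_newton_derivative_on F G D" "has_newton_derivative_on F' G' D"
  shows "has_newton_derivative_on (\<lambda>u. F u + F' u) (\<lambda>u. G u + G' u) D"
  unfolding has_newton_derivative_on_def
proof (intro conjI ballI)
  fix u assume "u \<in> D"
  let ?r = "\<lambda>F G h. F (u + h) - F u - blinfun_apply (G (u + h)) h"
  have lim: "((\<lambda>h. norm (?r F G h) / norm h + norm (?r F' G' h) / norm h) \<longlongrightarrow> 0) (at 0)"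
    using assms \<open>u \<in> D\<close> unfolding has_newton_derivative_on_def
    by (intro tendsto_add_zero) auto
  have eq: "?r (\<lambda>u. F u + F' u) (\<lambda>u. G u + G' u) h = ?r F G h + ?r F' G' h" for h
    by (simp add: blinfun.add_left)
  show "((\<lambda>h. norm (?r (\<lambda>u. F u + F' u) (\<lambda>u. G u + G' u) h) / norm h) \<longlongrightarrow> 0) (at 0)"
    unfolding eq
    by (rule Lim_null_comparison[OF _ lim])
      (simp add: add_divide_distrib[symmetric] divide_right_mono norm_triangle_ineq)
qed (use assms in \<open>simp add: has_newton_derivative_on_def\<close>)

text \<open>Testing the expansion at \<open>t *\<^sub>R h\<close> against the same vector and
  dividing by the square of \<open>t\<close> gives the bound at \<open>u + t *\<^sub>R h\<close> up
  to \<epsilon>; continuity of the quadratic form carries it to \<open>u\<close>. The case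
  \<open>c = 0\<close> turns condition (i) into condition (ii).\<close>

lemma newton_derivative_coercive:
  fixes F :: "'x::real_normed_vector \<Rightarrow> ('x \<Rightarrow>\<^sub>L real)"
  assumes newton: "has_newton_derivative_on F G UNIV"
    and mono: "\<And>h. c * (norm h)\<^sup>2 \<le> blinfun_apply (F (u + h) - F u) h"
    and cont: "\<And>h. isCont (\<lambda>w. blinfun_apply (blinfun_apply (G w) h) h) u"
  shows "c * (norm h)\<^sup>2 \<le> blinfun_apply (blinfun_apply (G u) h) h"
proof (cases "h = 0")
  case False
  let ?g = "\<lambda>w. blinfun_apply (blinfun_apply (G w) h) h"
  have "c * (norm h)\<^sup>2 \<le> ?g u + \<epsilon>" if "\<epsilon> > 0" for \<epsilon>
  proof -
    \<comment> \<open>Chosen so that the remainder tested against \<open>t *\<^sub>R h\<close> is at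
      most \<epsilon> times the square of \<open>t\<close>.\<close>
    define e where "e = \<epsilon> / (norm h)\<^sup>2"
    have e: "e > 0" "e * (norm h)\<^sup>2 = \<epsilon>" using that False by (simp_all add: e_def)
    obtain d where d: "d > 0" "\<And>k. norm k < d \<Longrightarrow>
        norm (F (u + k) - F u - blinfun_apply (G (u + k)) k) \<le> e * norm k"
      using newton e(1) unfolding has_newton_derivative_UNIV_iff by blast
    show ?thesis
    proof (rule tendsto_lowerbound)
      have "((\<lambda>t. u + t *\<^sub>R h) \<longlongrightarrow> u) (at_right 0)"
        by (rule tendsto_eq_intros | simp)+
      then have "((\<lambda>t. ?g (u + t *\<^sub>R h)) \<longlongrightarrow> ?g u) (at_right 0)"
        using isCont_tendsto_compose[OF cont[of h]] by blast
      then show "((\<lambda>t. ?g (u + t *\<^sub>R h) + \<epsilon>) \<longlongrightarrow> ?g u + \<epsilon>) (at_right 0)"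
        by (intro tendsto_add tendsto_const)
      have "\<forall>\<^sub>F t in at_right 0. 0 < t \<and> t < d / norm h"
        using d(1) False by (intro eventually_at_rightI[of 0 "d / norm h"]) auto
      then show "\<forall>\<^sub>F t in at_right 0. c * (norm h)\<^sup>2 \<le> ?g (u + t *\<^sub>R h) + \<epsilon>"
      proof eventually_elim
        case (elim t)
        let ?k = "t *\<^sub>R h"
        let ?R = "F (u + ?k) - F u - blinfun_apply (G (u + ?k)) ?k"
        have "norm ?k < d" using elim False by (simp add: field_simps)
        then have "norm ?R \<le> e * norm ?k" by (rule d(2))
        then have "norm ?R * norm ?k \<le> e * norm ?k * norm ?k"
          by (rule mult_right_mono) simp
        then have "blinfun_apply ?R ?k \<le> e * norm ?k * norm ?k"
          using norm_blinfun[of ?R ?k] by simp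
        then have "c * (norm ?k)\<^sup>2
            \<le> blinfun_apply (blinfun_apply (G (u + ?k)) ?k) ?k + e * norm ?k * norm ?k"
          using mono[of ?k] by (simp add: blinfun.diff_left)
        then have "t\<^sup>2 * (c * (norm h)\<^sup>2) \<le> t\<^sup>2 * (?g (u + ?k) + \<epsilon>)"
          using elim unfolding e(2)[symmetric]
          by (simp add: blinfun.scaleR_left blinfun.scaleR_right power2_eq_square algebra_simps)
        then show ?case using elim by simp
      qed
    qed simp
  qed
  then show ?thesis by (rule field_le_epsilon)
qed (simp add: blinfun.zero_right)

text \<open>The remainder of \<open>T\<close> involves \<open>N\<close> at
  \<open>S f + h = S (f + k)\<close>, the very operator that \<open>G (f + k)\<close> inverts on the
  range of \<open>j\<close>. Since \<open>c\<close> does not depend on the point, the error in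
  solving is controlled uniformly in \<open>k\<close>.\<close>

lemma newton_derivative_inverse:
  fixes T :: "'x::real_normed_vector \<Rightarrow> ('x \<Rightarrow>\<^sub>L real)"
    and j :: "'z::real_normed_vector \<Rightarrow> ('x \<Rightarrow>\<^sub>L real)"
  assumes newton: "has_newton_derivative_on T N UNIV"
    and c: "c > 0"
    and mono: "\<And>u v. c * (norm (u - v))\<^sup>2 \<le> blinfun_apply (T u - T v) (u - v)"
    and coer: "\<And>u h. c * (norm h)\<^sup>2 \<le> blinfun_apply (blinfun_apply (N u) h) h"
    and j: "bounded_linear j"
    and S: "\<And>f. T (S f) = j f"
    and G: "\<And>f h. blinfun_apply (N (S f)) (blinfun_apply (G f) h) = j h"
  shows "has_newton_derivative_on S G UNIV"
  unfolding has_newton_derivative_UNIV_iff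
proof (intro allI impI)
  fix f :: 'z and e :: real assume e: "e > 0"
  obtain K where K: "K > 0" "\<And>k. norm (j k) \<le> norm k * K"
    using bounded_linear.pos_bounded[OF j] by blast
  \<comment> \<open>One factor \<open>c / K\<close> compensates the Lipschitz bound
    \<open>c * norm h \<le> norm k * K\<close>, the other \<open>c\<close> the final use of
    coercivity. The same bound explains the radius \<open>d * c / K\<close>, which forces
    \<open>norm h < d\<close>.\<close>
  define e' where "e' = e * c\<^sup>2 / K"
  have "e' > 0" using e c K by (simp add: e'_def)
  then obtain d where d: "d > 0" "\<And>h. norm h < d \<Longrightarrow>
      norm (T (S f + h) - T (S f) - blinfun_apply (N (S f + h)) h) \<le> e' * norm h"
    using newton unfolding has_newton_derivative_UNIV_iff by blast
  have "norm (S (f + k) - S f - blinfun_apply (G (f + k)) k) \<le> e * norm k"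
    if k: "norm k < d * c / K" for k
  proof -
    define h where "h = S (f + k) - S f"
    define w where "w = blinfun_apply (G (f + k)) k"
    have Sh: "S f + h = S (f + k)" by (simp add: h_def)
    have Tjk: "T (S (f + k)) - T (S f) = j k"
      by (simp add: S linear_add[OF bounded_linear.linear[OF j]])
    have "c * norm h \<le> norm (j k)"
      unfolding Tjk[symmetric] h_def by (rule norm_le_if_coercive[OF mono])
    then have h: "c * norm h \<le> norm k * K" using K(2)[of k] by linarith
    also have "\<dots> < d * c" using k K(1) by (simp add: field_simps)
    finally have "norm h < d" using c by (simp add: mult.commute)
    from d(2)[OF this] have le: "norm (j k - blinfun_apply (N (S (f + k))) h) \<le> e' * norm h"
      by (simp add: Sh Tjk)
    have "c * norm (w - h) \<le> norm (blinfun_apply (N (S (f + k))) (w - h))"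
      by (rule norm_le_if_coercive) (rule coer)
    also have "blinfun_apply (N (S (f + k))) (w - h) = j k - blinfun_apply (N (S (f + k))) h"
      by (simp add: blinfun.diff_right w_def G)
    also note le
    also have "e' * norm h = e * c / K * (c * norm h)"
      by (simp add: e'_def power2_eq_square)
    also have "\<dots> \<le> e * c / K * (norm k * K)"
      using e c K h by (intro mult_left_mono) auto
    also have "\<dots> = c * (e * norm k)" using K by simp
    finally have "norm (w - h) \<le> e * norm k" using c by simp
    then show ?thesis by (simp add: h_def w_def norm_minus_commute)
  qed
  then show "\<exists>d>0. \<forall>k. norm k < d \<longrightarrow>
      norm (S (f + k) - S f - blinfun_apply (G (f + k)) k) \<le> e * norm k"
    using d(1) c K(1) by (intro exI[of _ "d * c / K"]) simp
qed

section \<open>Unique solvability and the Newton derivative of the solution map\<close>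

theorem theorem1:
  fixes A F :: "'x::banach \<Rightarrow> ('x \<Rightarrow>\<^sub>L real)"
    and A' G\<^sub>F :: "'x \<Rightarrow> ('x \<Rightarrow>\<^sub>L ('x \<Rightarrow>\<^sub>L real))"
    and j :: "('y::banach \<Rightarrow>\<^sub>L real) \<Rightarrow> ('x \<Rightarrow>\<^sub>L real)"
  assumes X_reflexive: "reflexive_space TYPE('x)" and Y_reflexive: "reflexive_space TYPE('y)"
    and j_bounded: "bounded_linear j" and j_inj: "inj j"
    and A_deriv: "\<And>u. (A has_derivative blinfun_apply (A' u)) (at u)"
    and A'_cont: "continuous_on UNIV A'"
    and A_strongly_monotone: "\<exists>c>0. \<forall>u h. blinfun_apply (A (u + h) - A u) h \<ge> c * (norm h)\<^sup>2"
    and A_expansion: "\<exists>M\<ge>0. \<forall>u. \<exists>r>0. \<forall>h. norm h < r \<longrightarrow>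
          (\<exists>w. blinfun_apply (A (u + h) - A u) h =
                 blinfun_apply (blinfun_apply (A' u) h) h + blinfun_apply w h \<and>
               norm w \<le> M * (norm h)\<^sup>2)"
    and F_monotone: "monotone_operator F" and F_cont: "continuous_on UNIV F"
    and F_newton: "has_newton_derivative_on F G\<^sub>F UNIV"
    and G\<^sub>F_cond: "(\<forall>u h. isCont (\<lambda>w. blinfun_apply (blinfun_apply (G\<^sub>F w) h) h) u) \<or>
         (\<forall>u h. blinfun_apply (blinfun_apply (G\<^sub>F u) h) h \<ge> 0)"
  shows "(\<forall>f. \<exists>!u. A u + F u = j f) \<and>
    (\<exists>(S :: ('y \<Rightarrow>\<^sub>L real) \<Rightarrow> 'x) (G\<^sub>S :: ('y \<Rightarrow>\<^sub>L real) \<Rightarrow> (('y \<Rightarrow>\<^sub>L real) \<Rightarrow>\<^sub>L 'x)).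
       (\<forall>f. A (S f) + F (S f) = j f) \<and>
       (\<forall>f h. \<exists>!w. blinfun_apply (A' (S f)) w + blinfun_apply (G\<^sub>F (S f)) w = j h) \<and>
       (\<forall>f h. blinfun_apply (A' (S f)) (blinfun_apply (G\<^sub>S f) h) +
              blinfun_apply (G\<^sub>F (S f)) (blinfun_apply (G\<^sub>S f) h) = j h) \<and>
       has_newton_derivative_on S G\<^sub>S UNIV)"
proof -
  obtain c where c: "c > 0" "\<And>u h. c * (norm h)\<^sup>2 \<le> blinfun_apply (A (u + h) - A u) h"
    using A_strongly_monotone by blast
  have A_newton: "has_newton_derivative_on A A' UNIV"
    by (rule C1_has_newton_derivative[OF A_deriv A'_cont])
  have A'_coercive: "c * (norm h)\<^sup>2 \<le> blinfun_apply (blinfun_apply (A' u) h) h" for u h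
  proof (rule newton_derivative_coercive[OF A_newton c(2)])
    have "isCont A' u" using A'_cont by (simp add: continuous_on_eq_continuous_at)
    then show "isCont (\<lambda>w. blinfun_apply (blinfun_apply (A' w) h) h) u" for h
      by (intro continuous_intros)
  qed
  have F_mono: "0 \<le> blinfun_apply (F (u + h) - F u) h" for u h
    using F_monotone by (simp add: monotone_operator_def)
  have G_nonneg: "0 \<le> blinfun_apply (blinfun_apply (G\<^sub>F u) h) h" for u h
    \<comment> \<open>Condition (i) enters through the coercivity lemma with constant 0; condition
      (ii) is the claim itself.\<close>
    using G\<^sub>F_cond newton_derivative_coercive[OF F_newton, of 0 u h] F_mono by auto
  define T where "T u = A u + F u" for u
  define N where "N u = A' u + G\<^sub>F u" for u
  have T_newton: "has_newton_derivative_on T N UNIV"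
    unfolding T_def N_def by (rule has_newton_derivative_add[OF A_newton F_newton])
  have T_mono: "c * (norm (u - v))\<^sup>2 \<le> blinfun_apply (T u - T v) (u - v)" for u v
    using c(2)[of "u - v" v] F_mono[of v "u - v"] by (simp add: T_def blinfun.bilinear_simps)
  have N_coercive: "c * (norm h)\<^sup>2 \<le> blinfun_apply (blinfun_apply (N u) h) h" for u h
    using A'_coercive[of h u] G_nonneg[of u h] by (simp add: N_def blinfun.add_left)
  have "continuous_on UNIV A"
    using A_deriv has_derivative_continuous by (blast intro: continuous_at_imp_continuous_on)
  then have "continuous_on UNIV T" unfolding T_def by (intro continuous_intros F_cont)
  \<comment> \<open>The derivative of \<open>A\<close> at any single point provides the inner
    product.\<close>
  then have "\<exists>u. T u = g" for g
    using strongly_monotone_surjective[OF _ c(1) T_mono c(1) A'_coercive] by metis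
  moreover have T_inj: "u = v" if "T u = T v" for u v
    using norm_le_if_coercive[OF T_mono[of u v]] that c(1) by (simp add: mult_le_0_iff)
  ultimately have ex1: "\<exists>!u. T u = g" for g by metis
  define S where "S f = (THE u. T u = j f)" for f
  have S: "T (S f) = j f" for f unfolding S_def by (rule theI'[OF ex1])
  have "\<exists>J. \<forall>g w. blinfun_apply (N u) w = g \<longleftrightarrow> w = blinfun_apply J g" for u
    using lax_milgram[OF c(1) N_coercive] by metis
  then obtain J where J: "\<And>u g w. blinfun_apply (N u) w = g \<longleftrightarrow> w = blinfun_apply (J u) g"
    by metis
  \<comment> \<open>The inverse of \<open>N (S f)\<close> is a bounded operator by the Lax-Milgram
    lemma, so composing it with the embedding \<open>j\<close> gives a bounded operator into
    \<open>'x\<close>.\<close>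
  define G\<^sub>S where "G\<^sub>S f = J (S f) o\<^sub>L Blinfun j" for f
  have G\<^sub>S: "blinfun_apply (N (S f)) (blinfun_apply (G\<^sub>S f) h) = j h" for f h
    unfolding G\<^sub>S_def by (simp add: J bounded_linear_Blinfun_apply[OF j_bounded])
  have "has_newton_derivative_on S G\<^sub>S UNIV"
    by (rule newton_derivative_inverse[OF T_newton c(1) T_mono N_coercive j_bounded S G\<^sub>S])
  moreover have "\<exists>!w. blinfun_apply (N (S f)) w = j h" for f h
    by (simp add: J)
  ultimately show ?thesis
    using ex1 S G\<^sub>S unfolding T_def N_def blinfun.add_left
    by (intro conjI allI exI[of _ S] exI[of _ G\<^sub>S]) auto
qed

end
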